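(* Let $L$ be a $BL$-algebra and $F:L\to[0,1]$ a fuzzy set. Then $F$ is an $(\overline{\in},\overline{\in}\vee\overline{q})$-fuzzy filter of $L$ if and only if for every $t\in(0.5,1]$ for which $U(F;t)=\{x\in L\mid F(x)\ge t\}$ is non-empty, $U(F;t)$ is a filter of $L$.
   Context: A $BL$-algebra is an algebra $(L,\le,\wedge,\vee,\odot,\rightarrow,0,1)$ that is a bounded lattice (least element $0$, greatest element $1$) such that $(L,\odot,1)$ is a commutative monoid, $z\le x\rightarrow y$ iff $x\odot z\le y$, $x\wedge y=x\odot(x\rightarrow y)$, and $(x\rightarrow y)\vee(y\rightarrow x)=1$, for all $x,y,z\in L$. A filter of $L$ is a non-empty subset $A\subseteq L$ with $1\in A$ such that $x\in A$ and $x\rightarrow y\in A$ imply $y\in A$. For $x\in L$ and $t\in(0,1]$, the fuzzy point $U(x;t)$ is said to belong to $F$, written $U(x;t)\in F$, if $F(x)\ge t$, and to be quasi-coincident with $F$, written $U(x;t)\,q\,F$, if $F(x)+t>1$; $\overline{\in}$ and $\overline{q}$ denote the negations of these relations, and $U(x;t)\,\overline{\in}\vee\overline{q}\,F$ means $U(x;t)\,\overline{\in}\,F$ or $U(x;t)\,\overline{q}\,F$. A fuzzy set $F$ is an $(\overline{\in},\overline{\in}\vee\overline{q})$-fuzzy filter of $L$ if for all $t,r\in(0,1]$ and $x,y\in L$: (i) if $U(x\odot y;\min\{t,r\})\,\overline{\in}\,F$ then $U(x;t)\,\overline{\in}\vee\overline{q}\,F$ or $U(y;r)\,\overline{\in}\vee\overline{q}\,F$;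 (ii) if $x\le y$ and $U(y;r)\,\overline{\in}\,F$ then $U(x;r)\,\overline{\in}\vee\overline{q}\,F$. *)

theory Defs
  imports Complex_Main
begin

text \<open>BL-algebras as a type class: the carrier is the whole type, the monoid operation is
  \<open>*\<close>, and the least and greatest elements are \<open>bot\<close> and \<open>1 = top\<close>.\<close>

class bl_algebra = bounded_lattice + comm_monoid_mult +
  fixes bl_imp :: "'a \<Rightarrow> 'a \<Rightarrow> 'a"  (infixr "\<rightarrow>\<^sub>B" 60)
  assumes top_eq_one: "top = 1"
    and residuation: "z \<le> (x \<rightarrow>\<^sub>B y) \<longleftrightarrow> x * z \<le> y"
    and divisibility: "inf x y = x * (x \<rightarrow>\<^sub>B y)"
    and prelinearity: "sup (x \<rightarrow>\<^sub>B y) (y \<rightarrow>\<^sub>B x) = 1"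

definition bl_filter :: "'a::bl_algebra set \<Rightarrow> bool" where
  "bl_filter A \<longleftrightarrow> A \<noteq> {} \<and> 1 \<in> A \<and> (\<forall>x y. x \<in> A \<and> (x \<rightarrow>\<^sub>B y) \<in> A \<longrightarrow> y \<in> A)"

definition fuzzy_set :: "('a \<Rightarrow> real) \<Rightarrow> bool" where
  "fuzzy_set F \<longleftrightarrow> (\<forall>x. 0 \<le> F x \<and> F x \<le> 1)"

text \<open>The fuzzy point \<open>U(x;t)\<close> enters only through the following two relations to \<open>F\<close>, so it is
  represented by its support \<open>x\<close> and its value \<open>t\<close>, with \<open>0 < t \<le> 1\<close> required at each use.\<close>

definition point_belongs :: "'a \<Rightarrow> real \<Rightarrow> ('a \<Rightarrow> real) \<Rightarrow> bool" where
  "point_belongs x t F \<longleftrightarrow> F x \<ge> t"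

definition point_quasi_coincident :: "'a \<Rightarrow> real \<Rightarrow> ('a \<Rightarrow> real) \<Rightarrow> bool" where
  "point_quasi_coincident x t F \<longleftrightarrow> F x + t > 1"

definition point_not_in_or_not_q :: "'a \<Rightarrow> real \<Rightarrow> ('a \<Rightarrow> real) \<Rightarrow> bool" where
  "point_not_in_or_not_q x t F \<longleftrightarrow> \<not> point_belongs x t F \<or> \<not> point_quasi_coincident x t F"

definition not_in_not_in_or_not_q_fuzzy_filter :: "('a::bl_algebra \<Rightarrow> real) \<Rightarrow> bool" where
  "not_in_not_in_or_not_q_fuzzy_filter F \<longleftrightarrow>
    (\<forall>t\<in>{0<..1}. \<forall>r\<in>{0<..1}. \<forall>x y.
      (\<not> point_belongs (x * y) (min t r) F \<longrightarrow>
         point_not_in_or_not_q x t F \<or> point_not_in_or_not_q y r F) \<and>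
      (x \<le> y \<and> \<not> point_belongs y r F \<longrightarrow> point_not_in_or_not_q x r F))"

definition level_set :: "('a \<Rightarrow> real) \<Rightarrow> real \<Rightarrow> 'a set" where
  "level_set F t = {x. F x \<ge> t}"

end

theory Submission imports Defs begin

text \<open>Taking both thresholds equal to \<open>min (F x) (F y)\<close>, respectively \<open>F x\<close>, turns the two conditions on
  fuzzy points into \<open>min (F x) (F y) \<le> max (F (x * y)) (1/2)\<close> and, for \<open>x \<le> y\<close>,
  \<open>F x \<le> max (F y) (1/2)\<close>. These say that every level set above \<open>1/2\<close> is an upset closed under
  multiplication, which by residuation characterises filters among non-empty sets.\<close>

lemma bl_imp_eq_one_iff: "(x \<rightarrow>\<^sub>B y) = 1 \<longleftrightarrow> x \<le> y" for x y :: "'a::bl_algebra"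
  by (metis residuation top_eq_one top_le top_greatest mult.right_neutral)

lemma mult_bl_imp_le: "x * (x \<rightarrow>\<^sub>B y) \<le> y" for x y :: "'a::bl_algebra"
  using residuation by blast

text \<open>Since \<open>x \<le> y\<close> means that the implication from \<open>x\<close> to
  \<open>y\<close> is \<open>1\<close>, modus ponens contains upward closure. Conversely, an upset
  closed under \<open>*\<close> admits modus ponens by \<open>mult_bl_imp_le\<close>.\<close>

lemma bl_filter_iff:
  fixes A :: "'a::bl_algebra set"
  shows "bl_filter A \<longleftrightarrow> A \<noteq> {} \<and> (\<forall>x\<in>A. \<forall>y\<in>A. x * y \<in> A) \<and> (\<forall>x\<in>A. \<forall>y. x \<le> y \<longrightarrow> y \<in> A)"
    (is "_ \<longleftrightarrow> ?R")
proof
  assume A: "bl_filter A"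
  then have mp: "y \<in> A" if "x \<in> A" "(x \<rightarrow>\<^sub>B y) \<in> A" for x y
    using that unfolding bl_filter_def by blast
  have up: "y \<in> A" if "x \<in> A" "x \<le> y" for x y
    using A mp that bl_imp_eq_one_iff unfolding bl_filter_def by metis
  have "x * y \<in> A" if "x \<in> A" "y \<in> A" for x y
  proof -
    \<comment> \<open>By residuation this is just \<open>y * x \<le> x * y\<close>. Upward closure
      then puts the implication into \<open>A\<close>, and modus ponens with \<open>y\<close> yields
      the product.\<close>
    have "x \<le> (y \<rightarrow>\<^sub>B (x * y))"
      by (simp add: residuation mult.commute)
    then show ?thesis using that up mp by blast
  qed
  with A up show ?R unfolding bl_filter_def by blast
next
  assume R: ?R
  have "1 \<in> A"
    using R by (metis all_not_in_conv top_eq_one top_greatest)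
  then show "bl_filter A"
    using R mult_bl_imp_le unfolding bl_filter_def by blast
qed

text \<open>The constant \<open>1/2\<close> comes from quasi-coincidence: \<open>t \<le> F x\<close>
  and \<open>F x + t > 1\<close> together force \<open>F x > 1/2\<close>, while a threshold
  \<open>t = F x\<close> meets both as soon as \<open>F x > 1/2\<close>.\<close>

lemma not_in_not_in_or_not_q_fuzzy_filter_iff:
  fixes F :: "'a::bl_algebra \<Rightarrow> real"
  assumes "fuzzy_set F"
  shows "not_in_not_in_or_not_q_fuzzy_filter F \<longleftrightarrow>
    (\<forall>x y. min (F x) (F y) \<le> max (F (x * y)) (1/2)) \<and>
    (\<forall>x y. x \<le> y \<longrightarrow> F x \<le> max (F y) (1/2))"
    (is "_ \<longleftrightarrow> ?R")
proof
  assume filt: "not_in_not_in_or_not_q_fuzzy_filter F"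
  have le1: "F x \<le> 1" for x
    using assms by (simp add: fuzzy_set_def)
  note defs = not_in_not_in_or_not_q_fuzzy_filter_def point_not_in_or_not_q_def
    point_belongs_def point_quasi_coincident_def
  have mult: "min t r \<le> F (x * y)"
    if "0 < t" "t \<le> 1" "0 < r" "r \<le> 1" "t \<le> F x" "F x + t > 1" "r \<le> F y" "F y + r > 1"
    for t r x y
    using filt that unfolding defs by force
  have up: "r \<le> F y" if "0 < r" "r \<le> 1" "x \<le> y" "r \<le> F x" "F x + r > 1" for r x y
    using filt that unfolding defs by force
  have "min (F x) (F y) \<le> max (F (x * y)) (1/2)" for x y
    \<comment> \<open>If the minimum exceeds \<open>1/2\<close>, its sum with \<open>F x\<close> or
      \<open>F y\<close> exceeds 1, so \<open>mult\<close> applies; otherwise the bound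
      \<open>1/2\<close> suffices.\<close>
    using mult[of "min (F x) (F y)" "min (F x) (F y)" x y] le1[of x] le1[of y] by linarith
  moreover have "F x \<le> max (F y) (1/2)" if "x \<le> y" for x y
    using up[of "F x" x y] le1[of x] that by linarith
  ultimately show ?R by blast
next
  assume R: ?R
  \<comment> \<open>If all four alternatives failed, \<open>F x\<close> and \<open>F y\<close> would
    exceed \<open>1/2\<close>, so \<open>R\<close> would give
    \<open>F (x * y) \<ge> min (F x) (F y) \<ge> min t r\<close>.\<close>
  have mult: "t > F x \<or> F x + t \<le> 1 \<or> r > F y \<or> F y + r \<le> 1" if "F (x * y) < min t r" for x y t r
  proof -
    have "min (F x) (F y) \<le> max (F (x * y)) (1/2)" using R by blast
    with that show ?thesis by linarith
  qed
  have up: "r > F x \<or> F x + r \<le> 1" if "x \<le> y" "F y < r" for x y r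
  proof -
    have "F x \<le> max (F y) (1/2)" using R that by blast
    with that show ?thesis by linarith
  qed
  show "not_in_not_in_or_not_q_fuzzy_filter F"
    unfolding not_in_not_in_or_not_q_fuzzy_filter_def point_not_in_or_not_q_def
      point_belongs_def point_quasi_coincident_def not_le not_less
    using mult up by blast
qed

theorem theorem2p5:
  fixes F :: "'a::bl_algebra \<Rightarrow> real"
  assumes "fuzzy_set F"
  shows "not_in_not_in_or_not_q_fuzzy_filter F \<longleftrightarrow>
    (\<forall>t\<in>{1/2<..1}. level_set F t \<noteq> {} \<longrightarrow> bl_filter (level_set F t))"
  unfolding not_in_not_in_or_not_q_fuzzy_filter_iff[OF assms]
proof (intro iffI ballI impI conjI allI)
  fix t :: real
  assume R: "(\<forall>x y. min (F x) (F y) \<le> max (F (x * y)) (1/2)) \<and>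
    (\<forall>x y. x \<le> y \<longrightarrow> F x \<le> max (F y) (1/2))"
    and t: "t \<in> {1/2<..1}" and ne: "level_set F t \<noteq> {}"
  \<comment> \<open>As \<open>t > 1/2\<close>, the maximum in \<open>R\<close> can only be attained
    by the value of \<open>F\<close>.\<close>
  have "t \<le> F (x * y)" if "t \<le> F x" "t \<le> F y" for x y
  proof -
    have "min (F x) (F y) \<le> max (F (x * y)) (1/2)" using R by blast
    with that t show ?thesis by auto
  qed
  moreover have "t \<le> F y" if "t \<le> F x" "x \<le> y" for x y
  proof -
    have "F x \<le> max (F y) (1/2)" using R that by blast
    with that t show ?thesis by auto
  qed
  ultimately show "bl_filter (level_set F t)"
    using ne unfolding bl_filter_iff by (auto simp: level_set_def)
next
  assume L: "\<forall>t\<in>{1/2<..1}. level_set F t \<noteq> {} \<longrightarrow> bl_filter (level_set F t)"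
  have le1: "F x \<le> 1" for x
    using assms by (simp add: fuzzy_set_def)
  \<comment> \<open>The point \<open>x\<close> witnesses non-emptiness, and
    \<open>F x \<le> 1\<close> keeps \<open>t\<close> in the admissible range.\<close>
  have filt: "bl_filter (level_set F t)" if "1/2 < t" "t \<le> F x" for t x
    using L that le1[of x] by (auto simp: level_set_def)
  show "min (F x) (F y) \<le> max (F (x * y)) (1/2)" for x y
  proof (cases "1/2 < min (F x) (F y)")
    case True
    \<comment> \<open>This is the highest level whose set contains both \<open>x\<close> and
      \<open>y\<close>, so membership of the product is exactly the required bound.\<close>
    then have "bl_filter (level_set F (min (F x) (F y)))"
      by (rule filt[of _ x]) simp
    then have "x * y \<in> level_set F (min (F x) (F y))"
      unfolding bl_filter_iff by (simp add: level_set_def)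
    then show ?thesis by (simp add: level_set_def)
  qed linarith
  show "F x \<le> max (F y) (1/2)" if "x \<le> y" for x y
  proof (cases "1/2 < F x")
    case True
    then have "bl_filter (level_set F (F x))"
      by (rule filt[of _ x]) simp
    then have "y \<in> level_set F (F x)"
      using that unfolding bl_filter_iff by (auto simp: level_set_def)
    then show ?thesis by (simp add: level_set_def)
  qed linarith
qed

end
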